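(* Let $n, m \ge 1$ be integers, and for each $i,j\in\{1,\dots,n\}$ let $p_{ij}^1,\dots,p_{ij}^m$ be fixed polynomials in $s$ with real coefficients. Put $$\mathcal P_{ij}=\Big\{\sum_{k=1}^m \lambda_{ij}^k p_{ij}^k:\ \lambda_{ij}^k\ge 0,\ \sum_{k=1}^m\lambda_{ij}^k=1\Big\},$$ $$K_{ij}=\{p_{ij}^k:\ k=1,\dots,m\},\qquad E_{ij}=\{\lambda p_{ij}^a+(1-\lambda)p_{ij}^b:\ a,b\in\{1,\dots,m\},\ \lambda\in[0,1]\},$$ and let $$\mathcal A=\{(p_{ij})_{n\times n}:\ p_{ij}\in\mathcal P_{ij},\ i,j=1,\dots,n\}.$$ Let $\epsilon_{\mathcal A}$ be the set of all $n\times n$ polynomial matrices $(p_{ij})_{n\times n}$ for which there exists a permutation $(l_1,\dots,l_n)$ of $(1,\dots,n)$ such that, for every $r\in\{1,\dots,n\}$, $p_{r l_r}\in E_{r l_r}$ and $p_{r j}\in K_{r j}$ for all $j\in\{1,\dots,n\}\setminus\{l_r\}$. Let $D\subset\mathbb C$ be a simply connected open region. Suppose that $\deg(\det A)$ is the same for all $A\in\mathcal A$. Then $\mathcal A$ is $D$-stable if and only if $\epsilon_{\mathcal A}$ is $D$-stable.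
   Context: A polynomial matrix $A$ (a square matrix whose entries are polynomials in $s$) is $D$-stable, for an open region $D\subset\mathbb C$, if all (complex) roots of $\det A=0$ (as a polynomial equation in $s$) lie in $D$. A set of polynomial matrices is $D$-stable if every member of it is $D$-stable. *)

theory Defs
  imports "HOL-Analysis.Analysis" "HOL-Computational_Algebra.Polynomial"
begin

definition D_stable :: "complex set \<Rightarrow> real poly ^ 'n ^ 'n \<Rightarrow> bool" where
  "D_stable D A \<longleftrightarrow> (\<forall>s. poly (map_poly complex_of_real (det A)) s = 0 \<longrightarrow> s \<in> D)"

definition D_stable_set :: "complex set \<Rightarrow> (real poly ^ 'n ^ 'n) set \<Rightarrow> bool" where
  "D_stable_set D S \<longleftrightarrow> (\<forall>A\<in>S. D_stable D A)"

definition poly_hull :: "nat \<Rightarrow> (nat \<Rightarrow> real poly) \<Rightarrow> real poly set" where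
  "poly_hull m q = {\<Sum>k=1..m. smult (c k) (q k) | c.
     (\<forall>k\<in>{1..m}. 0 \<le> c k) \<and> (\<Sum>k=1..m. c k) = 1}"

definition poly_vertices :: "nat \<Rightarrow> (nat \<Rightarrow> real poly) \<Rightarrow> real poly set" where
  "poly_vertices m q = {q k | k. k \<in> {1..m}}"

definition poly_edges :: "nat \<Rightarrow> (nat \<Rightarrow> real poly) \<Rightarrow> real poly set" where
  "poly_edges m q = {smult t (q a) + smult (1 - t) (q b) | a b t.
     a \<in> {1..m} \<and> b \<in> {1..m} \<and> t \<in> {0..1}}"

definition matrix_family ::
    "nat \<Rightarrow> ('n \<Rightarrow> 'n \<Rightarrow> nat \<Rightarrow> real poly) \<Rightarrow> (real poly ^ 'n ^ 'n) set" where
  "matrix_family m p = {A. \<forall>i j. A $ i $ j \<in> poly_hull m (p i j)}"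

definition edge_matrices ::
    "nat \<Rightarrow> ('n \<Rightarrow> 'n \<Rightarrow> nat \<Rightarrow> real poly) \<Rightarrow> (real poly ^ 'n ^ 'n) set" where
  "edge_matrices m p = {A. \<exists>l. l permutes UNIV \<and>
     (\<forall>r. A $ r $ l r \<in> poly_edges m (p r (l r)) \<and>
          (\<forall>j. j \<noteq> l r \<longrightarrow> A $ r $ j \<in> poly_vertices m (p r j)))}"

(* The library's degree sends the zero polynomial to 0, so it cannot tell a determinant
   that vanishes identically from a nonzero constant one; here deg 0 is minus infinity. *)
definition ext_degree :: "'a::zero poly \<Rightarrow> ereal" where
  "ext_degree q = (if q = 0 then -\<infinity> else ereal (real (degree q)))"

end

theory Submission
  imports Defs "HOL-Complex_Analysis.Riemann_Mapping"
begin

text \<open>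
  Every member of the matrix family is given by an array of convex coefficients, one vector of
  weights for each entry. Edge matrices are members of the family, so one direction is clear.
  For the other, suppose that some member has a determinant with a root outside \<open>D\<close>, and choose
  one whose coefficient array has a support of minimal size. It turns out to be an edge matrix.

  The reason is that on a single row or column the determinant is an affine function of the
  coefficients. If a row or column has more than one edge's worth of freedom, that is, two
  independent directions in which weight can be moved within the support, the determinant runs
  through a two-parameter affine family \<open>f + x g + y h\<close> over a compact polygon. The argument behind
  the edge theorem for polytopes of polynomials (\<open>bad_root_on_frontier\<close>) then provides a
  point on the frontier of the polygon whose determinant also has a root outside \<open>D\<close>. On the frontier
  some weight is zero, and the support has become smaller (\<open>shrink_support\<close>), against
  minimality. This is the place where constancy of the degree and simple connectedness of \<open>D\<close> enter:
  the first bounds the roots, the second makes the components of the complement of \<open>D\<close> unbounded.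

  So in each row and in each column at most one entry is not a vertex, and such an entry lies on
  an edge. That this holds for rows and columns at the same time comes for free, because moves
  along either never enlarge the support. The positions of the non-vertex entries
  form a partial matching, which extends to a permutation
  (\<open>sparse_support_edge_matrix\<close>); this is the permutation in the definition of edge matrices.
\<close>

section \<open>Polynomials with real coefficients at complex points\<close>

abbreviation cpoly :: "real poly \<Rightarrow> complex \<Rightarrow> complex" where
  "cpoly q s \<equiv> poly (map_poly complex_of_real q) s"

lemma cpoly_add: "cpoly (q + r) s = cpoly q s + cpoly r s"
proof -
  have "map_poly complex_of_real (q + r) = map_poly complex_of_real q + map_poly complex_of_real r"
    by (intro poly_eqI) (simp add: coeff_map_poly)
  then show ?thesis by simp
qed

lemma cpoly_smult: "cpoly (smult c q) s = of_real c * cpoly q s"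
  by (simp add: map_poly_smult)

lemma cpoly_altdef: "cpoly q s = (\<Sum>i\<le>degree q. of_real (coeff q i) * s ^ i)"
  by (simp add: poly_altdef degree_map_poly coeff_map_poly)

section \<open>The edge argument for two parameters\<close>

text \<open>The roots of a polynomial with leading coefficient \<open>a\<close> are bounded in terms of the
  moduli of the other coefficients divided by \<open>\<bar>a\<bar>\<close>. Constancy of the degree keeps \<open>a\<close> away from
  zero on the compact parameter set; without it, roots could escape to infinity.\<close>

lemma bounded_roots_compact_family:
  fixes F :: "'b::topological_space \<Rightarrow> real poly"
  assumes "compact K"
    and cont: "\<And>i. continuous_on K (\<lambda>z. coeff (F z) i)"
    and deg: "\<And>z. z \<in> K \<Longrightarrow> F z \<noteq> 0 \<and> degree (F z) = d"
  shows "bounded {s. \<exists>z\<in>K. cpoly (F z) s = 0}"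
proof (cases "K = {}")
  case False
  have "continuous_on K (\<lambda>z. \<bar>coeff (F z) d\<bar>)"
    by (intro continuous_intros cont)
  then obtain z0 where z0: "z0 \<in> K" "\<And>z. z \<in> K \<Longrightarrow> \<bar>coeff (F z0) d\<bar> \<le> \<bar>coeff (F z) d\<bar>"
    using continuous_attains_inf[OF assms(1) False] by blast
  define \<delta> where "\<delta> = \<bar>coeff (F z0) d\<bar>"
  have \<delta>: "\<delta> > 0" "\<And>z. z \<in> K \<Longrightarrow> \<delta> \<le> \<bar>coeff (F z) d\<bar>"
    using z0 deg[OF z0(1)] by (auto simp: \<delta>_def)
  have "continuous_on K (\<lambda>z. \<Sum>i<d. \<bar>coeff (F z) i\<bar>)"
    by (intro continuous_intros cont)
  then obtain z1 where
    z1: "\<And>z. z \<in> K \<Longrightarrow> (\<Sum>i<d. \<bar>coeff (F z) i\<bar>) \<le> (\<Sum>i<d. \<bar>coeff (F z1) i\<bar>)"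
    using continuous_attains_sup[OF assms(1) False] by blast
  define M where "M = (\<Sum>i<d. \<bar>coeff (F z1) i\<bar>)"
  have M0: "0 \<le> M" unfolding M_def by (intro sum_nonneg) auto
  have "norm s \<le> 1 + M / \<delta>" if "z \<in> K" and root: "cpoly (F z) s = 0" for z s
  proof (cases "norm s \<le> 1")
    case True
    then show ?thesis using M0 \<delta>(1) by (simp add: add_increasing2)
  next
    case False
    let ?c = "coeff (F z)"
    have "(\<Sum>i<d. of_real (?c i) * s ^ i) + of_real (?c d) * s ^ d = 0"
      using root deg[OF \<open>z \<in> K\<close>] by (simp add: cpoly_altdef lessThan_Suc_atMost[symmetric])
    then have "of_real (?c d) * s ^ d = - (\<Sum>i<d. of_real (?c i) * s ^ i)"
      by (metis add.commute eq_neg_iff_add_eq_0)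
    then have "\<bar>?c d\<bar> * norm s ^ d = norm (\<Sum>i<d. of_real (?c i) * s ^ i)"
      by (metis norm_minus_cancel norm_mult norm_of_real norm_power)
    also have "\<dots> \<le> (\<Sum>i<d. \<bar>?c i\<bar> * norm s ^ i)"
      by (rule order.trans[OF norm_sum]) (simp add: norm_mult norm_power)
    also have "\<dots> \<le> (\<Sum>i<d. \<bar>?c i\<bar> * norm s ^ (d - 1))"
      using False by (intro sum_mono mult_left_mono power_increasing) auto
    also have "\<dots> \<le> M * norm s ^ (d - 1)"
      using z1[OF \<open>z \<in> K\<close>] by (simp add: M_def sum_distrib_right[symmetric] mult_right_mono)
    finally have le: "\<bar>?c d\<bar> * norm s ^ d \<le> M * norm s ^ (d - 1)" .
    have "d \<noteq> 0"
    proof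
      assume "d = 0"
      then have "\<bar>?c d\<bar> \<le> 0" using le by (simp add: M_def)
      then show False using \<delta>(1) \<delta>(2)[OF \<open>z \<in> K\<close>] by linarith
    qed
    then have "norm s ^ d = norm s * norm s ^ (d - 1)"
      by (cases d) auto
    then have "(\<bar>?c d\<bar> * norm s) * norm s ^ (d - 1) \<le> M * norm s ^ (d - 1)"
      using le by (simp add: mult.assoc)
    moreover have "norm s ^ (d - 1) > 0"
      using False by (intro zero_less_power) linarith
    ultimately have "\<bar>?c d\<bar> * norm s \<le> M"
      by (rule mult_right_le_imp_le)
    then have "\<delta> * norm s \<le> M"
      using \<delta>(2)[OF \<open>z \<in> K\<close>] by (meson mult_right_mono norm_ge_zero order_trans)
    then show ?thesis
      using \<delta>(1) by (simp add: field_simps)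
  qed
  then show ?thesis
    unfolding bounded_iff by blast
qed auto

text \<open>Cramer's rule for one complex equation in two real unknowns. The determinant
  \<open>Im (g * cnj h)\<close> vanishes exactly when \<open>g\<close> and \<open>h\<close> are linearly dependent over the reals.\<close>

lemma real_solve_2x2:
  fixes x y :: real and f g h :: complex
  assumes "Im (g * cnj h) \<noteq> 0"
  shows "f + of_real x * g + of_real y * h = 0 \<longleftrightarrow>
    x = - Im (f * cnj h) / Im (g * cnj h) \<and> y = Im (f * cnj g) / Im (g * cnj h)"
proof -
  define \<Delta> where "\<Delta> = Im g * Re h - Re g * Im h"
  have D: "\<Delta> \<noteq> 0" "Im (g * cnj h) = \<Delta>" using assms by (auto simp: \<Delta>_def)
  show ?thesis
  proof
    assume "f + of_real x * g + of_real y * h = 0"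
    then have e: "Re f + x * Re g + y * Re h = 0" "Im f + x * Im g + y * Im h = 0"
      by (simp_all add: complex_eq_iff)
    have "x * \<Delta> = - Im (f * cnj h)"
    proof -
      have "x * \<Delta> + Im (f * cnj h) = Re h * (Im f + x * Im g + y * Im h) - Im h * (Re f + x * Re g + y * Re h)"
        by (simp add: \<Delta>_def algebra_simps)
      then show ?thesis using e by simp
    qed
    moreover have "y * \<Delta> = Im (f * cnj g)"
    proof -
      have "y * \<Delta> - Im (f * cnj g) = Im g * (Re f + x * Re g + y * Re h) - Re g * (Im f + x * Im g + y * Im h)"
        by (simp add: \<Delta>_def algebra_simps)
      then show ?thesis using e by simp
    qed
    ultimately show "x = - Im (f * cnj h) / Im (g * cnj h) \<and> y = Im (f * cnj g) / Im (g * cnj h)"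
      using D by (simp add: field_simps)
  next
    assume "x = - Im (f * cnj h) / Im (g * cnj h) \<and> y = Im (f * cnj g) / Im (g * cnj h)"
    then have xy: "x * \<Delta> = - Im (f * cnj h)" "y * \<Delta> = Im (f * cnj g)" using D by auto
    have "\<Delta> * (Re f + x * Re g + y * Re h) = \<Delta> * Re f + (x * \<Delta>) * Re g + (y * \<Delta>) * Re h"
      by (simp add: algebra_simps)
    also have "\<dots> = 0" unfolding xy by (simp add: \<Delta>_def algebra_simps)
    finally have 1: "Re f + x * Re g + y * Re h = 0" using D by simp
    have "\<Delta> * (Im f + x * Im g + y * Im h) = \<Delta> * Im f + (x * \<Delta>) * Im g + (y * \<Delta>) * Im h"
      by (simp add: algebra_simps)
    also have "\<dots> = 0" unfolding xy by (simp add: \<Delta>_def algebra_simps)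
    finally have 2: "Im f + x * Im g + y * Im h = 0" using D by simp
    show "f + of_real x * g + of_real y * h = 0"
      using 1 2 by (simp add: complex_eq_iff)
  qed
qed

lemma real_dependent_pair:
  fixes g h :: complex
  assumes "Im (g * cnj h) = 0"
  obtains a b :: real where "(a, b) \<noteq> (0, 0)" "of_real a * g + of_real b * h = 0"
proof (cases "h = 0")
  case True
  then show ?thesis using that[of 0 1] by simp
next
  case False
  have "g * cnj h = of_real (Re (g * cnj h))"
    using assms by (simp add: complex_eq_iff)
  then have "of_real ((cmod h)\<^sup>2) * g = of_real (Re (g * cnj h)) * h"
    by (metis complex_norm_square mult.commute mult.left_commute)
  then have "of_real ((cmod h)\<^sup>2) * g + of_real (- Re (g * cnj h)) * h = 0"
    by (simp del: times_complex.simps complex_cnj)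
  moreover have "((cmod h)\<^sup>2, - Re (g * cnj h)) \<noteq> (0, 0)"
    using False by simp
  ultimately show ?thesis
    by (rule that[rotated])
qed

text \<open>The two-dimensional edge argument. Let \<open>s\<close> be a root outside \<open>D\<close> of the polynomial with
  parameter \<open>z\<close>. If the values \<open>g(s)\<close> and \<open>h(s)\<close> are dependent over the reals, there is a line
  through \<open>z\<close> along which \<open>s\<close> stays a root, and this line leaves the bounded set \<open>K\<close> through its
  frontier. If they are independent, the parameter is a continuous function of the root near
  \<open>s\<close>, so that, for \<open>z\<close> in the interior, all points near \<open>s\<close> are roots as well. If there were no
  root outside \<open>D\<close> with parameter on the frontier, the second case would always apply, and the
  root set, which is closed and bounded, would have no frontier point outside \<open>D\<close>. It would then
  contain a whole component of the complement of \<open>D\<close>; but these are unbounded, because \<open>D\<close> is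
  open and simply connected.\<close>

lemma bad_root_on_frontier:
  fixes f g h :: "real poly" and K :: "(real \<times> real) set"
  defines "P \<equiv> (\<lambda>z. f + smult (fst z) g + smult (snd z) h)"
  assumes K: "compact K"
    and D: "open D" "simply_connected D"
    and deg: "\<And>z. z \<in> K \<Longrightarrow> ext_degree (P z) = e"
    and z0: "z0 \<in> K" and s0: "cpoly (P z0) s0 = 0" "s0 \<notin> D"
  shows "\<exists>z\<in>frontier K. \<exists>s. cpoly (P z) s = 0 \<and> s \<notin> D"
proof (rule ccontr)
  assume no_frontier: "\<not> ?thesis"
  have evP: "cpoly (P z) s = cpoly f s + of_real (fst z) * cpoly g s + of_real (snd z) * cpoly h s"
    for z s by (simp add: P_def cpoly_add cpoly_smult)
  have "closed K" "bounded K"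
    using K by (auto simp: compact_imp_closed compact_imp_bounded)
  \<comment> \<open>Dependent values would let \<open>s\<close> remain a root along a line that reaches the frontier.\<close>
  have indep: "Im (cpoly g s * cnj (cpoly h s)) \<noteq> 0"
    if "z \<in> K" "cpoly (P z) s = 0" "s \<notin> D" for z s
  proof
    assume "Im (cpoly g s * cnj (cpoly h s)) = 0"
    then obtain a b :: real where ab: "(a, b) \<noteq> (0, 0)"
      "of_real a * cpoly g s + of_real b * cpoly h s = 0"
      using real_dependent_pair by blast
    define L where "L = range (\<lambda>t::real. z + t *\<^sub>R (a, b))"
    have "connected L"
      unfolding L_def by (intro connected_continuous_image continuous_intros connected_UNIV)
    moreover have "z \<in> L"
      unfolding L_def by (rule range_eqI[of _ _ 0]) (simp add: zero_prod_def[symmetric])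
    moreover have "L - K \<noteq> {}"
    proof
      assume "L - K = {}"
      then have "bounded L" using \<open>bounded K\<close> bounded_subset by blast
      then obtain B where B: "\<And>t. norm (z + t *\<^sub>R (a, b)) \<le> B"
        unfolding L_def bounded_iff by blast
      have n: "norm (a, b) > 0" using ab(1) by (simp add: zero_prod_def)
      have "norm (((B + norm z + 1) / norm (a, b)) *\<^sub>R (a, b))
          \<le> norm (z + ((B + norm z + 1) / norm (a, b)) *\<^sub>R (a, b)) + norm z"
        by (metis add_diff_cancel_left' norm_triangle_ineq4)
      also have "\<dots> \<le> B + norm z" by (intro add_right_mono B)
      finally show False
        using n order_trans[OF norm_ge_zero B[of 0]] by (simp del: scaleR_Pair)
    qed
    ultimately have "L \<inter> frontier K \<noteq> {}"
      using connected_Int_frontier that(1) by blast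
    then obtain t where t: "z + t *\<^sub>R (a, b) \<in> frontier K"
      unfolding L_def by blast
    have "cpoly (P (z + t *\<^sub>R (a, b))) s
        = cpoly (P z) s + of_real t * (of_real a * cpoly g s + of_real b * cpoly h s)"
      by (simp add: evP algebra_simps)
    then have "cpoly (P (z + t *\<^sub>R (a, b))) s = 0" using that(2) ab(2) by simp
    then show False using no_frontier t that(3) by blast
  qed
  define R where "R = {s. \<exists>z\<in>K. cpoly (P z) s = 0}"
  have "s0 \<in> R" using z0 s0 by (auto simp: R_def)
  \<comment> \<open>If one member vanished identically, all would, and \<open>s0\<close> would be a root on the frontier too.\<close>
  have nonzero: "P z \<noteq> 0" if "z \<in> K" for z
  proof
    assume "P z = 0"
    then have "e = - \<infinity>" using deg[OF that] by (simp add: ext_degree_def)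
    then have "P w = 0" if "w \<in> K" for w
      using deg[OF that] by (simp add: ext_degree_def split: if_splits)
    moreover have "frontier K \<subseteq> K" "frontier K \<noteq> {}"
      using \<open>closed K\<close> \<open>bounded K\<close> z0 frontier_subset_closed frontier_not_empty not_bounded_UNIV
      by blast+
    ultimately show False
      using no_frontier s0(2) by (metis map_poly_0 ex_in_conv poly_0 subsetD)
  qed
  have "bounded R"
    unfolding R_def
  proof (rule bounded_roots_compact_family[OF K])
    show "continuous_on K (\<lambda>z. coeff (P z) i)" for i
      unfolding P_def coeff_add coeff_smult by (intro continuous_intros)
    show "P z \<noteq> 0 \<and> degree (P z) = degree (P z0)" if "z \<in> K" for z
      using nonzero[OF that] nonzero[OF z0] deg[OF that] deg[OF z0]
      by (auto simp: ext_degree_def)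
  qed
  have "closed {zs. cpoly (P (fst zs)) (snd zs) = 0}"
    unfolding evP by (intro closed_Collect_eq continuous_intros)
  from closed_compact_projection[OF K this] have "closed R"
    by (simp add: R_def Bex_def)
  have open_at: "s1 \<in> interior R" if s1: "s1 \<in> R" "s1 \<notin> D" for s1
  proof -
    obtain z1 where z1: "z1 \<in> K" "cpoly (P z1) s1 = 0"
      using s1(1) unfolding R_def by blast
    then have "z1 \<in> interior K"
      using no_frontier that(2) \<open>closed K\<close> by (auto simp: frontier_def)
    \<comment> \<open>Near \<open>s1\<close>, Cramer's rule gives the parameter \<open>\<phi> s\<close> of the member that vanishes at \<open>s\<close>.\<close>
    define \<Delta> where "\<Delta> = (\<lambda>s. Im (cpoly g s * cnj (cpoly h s)))"
    define \<phi> where "\<phi> = (\<lambda>s. (- Im (cpoly f s * cnj (cpoly h s)) / \<Delta> s,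
      Im (cpoly f s * cnj (cpoly g s)) / \<Delta> s))"
    have "\<Delta> s1 \<noteq> 0" unfolding \<Delta>_def using indep z1 that(2) by blast
    have \<phi>: "cpoly (P z) s = 0 \<longleftrightarrow> z = \<phi> s" if "\<Delta> s \<noteq> 0" for s z
      using real_solve_2x2[OF that[unfolded \<Delta>_def]]
      by (simp add: evP \<phi>_def \<Delta>_def prod_eq_iff)
    have cont_\<Delta>: "continuous_on UNIV \<Delta>"
      unfolding \<Delta>_def by (intro continuous_intros)
    have "isCont \<phi> s1"
      unfolding \<phi>_def using cont_\<Delta> \<open>\<Delta> s1 \<noteq> 0\<close>
      by (intro continuous_intros) (simp_all add: continuous_on_eq_continuous_at)
    moreover have "\<phi> s1 \<in> interior K"
      using \<phi>[OF \<open>\<Delta> s1 \<noteq> 0\<close>] z1 \<open>z1 \<in> interior K\<close> by simp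
    ultimately have "\<forall>\<^sub>F s in nhds s1. \<phi> s \<in> interior K"
      unfolding continuous_at_open eventually_nhds using open_interior by blast
    moreover have "open {s. \<Delta> s \<noteq> 0}"
      by (intro open_Collect_neq cont_\<Delta> continuous_intros)
    then have "\<forall>\<^sub>F s in nhds s1. \<Delta> s \<noteq> 0"
      using eventually_nhds_in_open[of "{s. \<Delta> s \<noteq> 0}" s1] \<open>\<Delta> s1 \<noteq> 0\<close> by simp
    ultimately have "\<forall>\<^sub>F s in nhds s1. s \<in> R"
    proof eventually_elim
      case (elim s)
      then have "\<phi> s \<in> K" "cpoly (P (\<phi> s)) s = 0"
        using \<phi> interior_subset[of K] by blast+
      then show ?case unfolding R_def by blast
    qed
    then show ?thesis
      by (metis (mono_tags, lifting) eventually_nhds interiorI subsetI)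
  qed
  \<comment> \<open>An unbounded connected set outside \<open>D\<close> that meets \<open>R\<close> has to cross the frontier of \<open>R\<close>.\<close>
  define C where "C = connected_component_set (- D) s0"
  have "C \<in> components (- D)" using s0(2) by (auto simp: C_def components_def)
  then have "\<not> bounded C"
    using simply_connected_eq_unbounded_complement_components[OF D(1)] D(2) by blast
  then have "C - R \<noteq> {}"
    using \<open>bounded R\<close> bounded_subset by blast
  moreover have "s0 \<in> C" using s0(2) by (simp add: C_def)
  moreover have "connected C" by (simp add: C_def)
  ultimately have "C \<inter> frontier R \<noteq> {}"
    using connected_Int_frontier[of C R] \<open>s0 \<in> R\<close> by blast
  then obtain s1 where "s1 \<in> C" "s1 \<in> frontier R" by blast
  moreover have "s1 \<notin> D"
    using \<open>s1 \<in> C\<close> connected_component_subset unfolding C_def by blast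
  ultimately show False
    using open_at \<open>closed R\<close> frontier_subset_closed[of R] by (auto simp: frontier_def)
qed

section \<open>Matrices of convex combinations\<close>

definition comb_matrix ::
    "nat \<Rightarrow> ('n \<Rightarrow> 'n \<Rightarrow> nat \<Rightarrow> real poly) \<Rightarrow> ('n \<Rightarrow> 'n \<Rightarrow> nat \<Rightarrow> real) \<Rightarrow> real poly ^ 'n ^ 'n" where
  "comb_matrix m p c = (\<chi> i j. \<Sum>k=1..m. smult (c i j k) (p i j k))"

definition convex_coeffs :: "nat \<Rightarrow> ('n \<Rightarrow> 'n \<Rightarrow> nat \<Rightarrow> real) \<Rightarrow> bool" where
  "convex_coeffs m c \<longleftrightarrow> (\<forall>i j. (\<forall>k\<in>{1..m}. 0 \<le> c i j k) \<and> (\<Sum>k=1..m. c i j k) = 1)"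

text \<open>An entry is a vertex when it carries one index of the support, and lies on an edge when it
  carries at most two; so the size of the support measures how far a matrix is from
  \<open>edge_matrices\<close>.\<close>

definition supp :: "nat \<Rightarrow> ('n \<Rightarrow> 'n \<Rightarrow> nat \<Rightarrow> real) \<Rightarrow> ('n \<times> 'n \<times> nat) set" where
  "supp m c = {(i, j, k). k \<in> {1..m} \<and> c i j k \<noteq> 0}"

lemma finite_supp [simp]: "finite (supp m (c :: 'n::finite \<Rightarrow> 'n \<Rightarrow> nat \<Rightarrow> real))"
  by (rule finite_subset[of _ "UNIV \<times> UNIV \<times> {1..m}"]) (auto simp: supp_def)

lemma convex_coeffs_nonneg: "convex_coeffs m c \<Longrightarrow> k \<in> {1..m} \<Longrightarrow> 0 \<le> c i j k"
  by (auto simp: convex_coeffs_def)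

lemma convex_coeffs_le_1:
  assumes "convex_coeffs m c" "k \<in> {1..m}"
  shows "c i j k \<le> 1"
proof -
  have "c i j k \<le> (\<Sum>k=1..m. c i j k)"
    using assms by (intro member_le_sum) (auto simp: convex_coeffs_def)
  then show ?thesis using assms by (simp add: convex_coeffs_def)
qed

lemma matrix_family_eq: "matrix_family m p = comb_matrix m p ` {c. convex_coeffs m c}"
proof (intro subset_antisym subsetI)
  fix A assume "A \<in> matrix_family m p"
  then have "\<forall>i j. \<exists>c. A $ i $ j = (\<Sum>k=1..m. smult (c k) (p i j k)) \<and>
      (\<forall>k\<in>{1..m}. 0 \<le> c k) \<and> (\<Sum>k=1..m. c k) = 1"
    unfolding matrix_family_def poly_hull_def by blast
  then obtain c where "\<forall>i j. A $ i $ j = (\<Sum>k=1..m. smult (c i j k) (p i j k)) \<and>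
      (\<forall>k\<in>{1..m}. 0 \<le> c i j k) \<and> (\<Sum>k=1..m. c i j k) = 1"
    by metis
  then have "A = comb_matrix m p c" "convex_coeffs m c"
    by (simp_all add: comb_matrix_def convex_coeffs_def vec_eq_iff)
  then show "A \<in> comb_matrix m p ` {c. convex_coeffs m c}" by blast
qed (auto simp: matrix_family_def poly_hull_def comb_matrix_def convex_coeffs_def)

lemma poly_hull_vertex:
  fixes c :: "nat \<Rightarrow> real" and q :: "nat \<Rightarrow> real poly"
  assumes "\<And>k. k \<in> {1..m} \<Longrightarrow> c k \<noteq> 0 \<Longrightarrow> k = a" "a \<in> {1..m}" "(\<Sum>k=1..m. c k) = 1"
  shows "(\<Sum>k=1..m. smult (c k) (q k)) = q a"
proof -
  have zero: "\<forall>k\<in>{1..m} - {a}. c k = 0" using assms(1) by blast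
  have "(\<Sum>k=1..m. c k) = (\<Sum>k\<in>{a}. c k)"
    using zero assms(2) by (intro sum.mono_neutral_right) auto
  moreover have "(\<Sum>k=1..m. smult (c k) (q k)) = (\<Sum>k\<in>{a}. smult (c k) (q k))"
    using zero assms(2) by (intro sum.mono_neutral_right) auto
  ultimately show ?thesis using assms(3) by simp
qed

lemma poly_hull_edge:
  fixes c :: "nat \<Rightarrow> real" and q :: "nat \<Rightarrow> real poly"
  assumes "\<And>k. k \<in> {1..m} \<Longrightarrow> c k \<noteq> 0 \<Longrightarrow> k = a \<or> k = b"
    and ab: "a \<noteq> b" "a \<in> {1..m}" "b \<in> {1..m}"
    and c: "(\<Sum>k=1..m. c k) = 1" "\<forall>k\<in>{1..m}. 0 \<le> c k"
  shows "(\<Sum>k=1..m. smult (c k) (q k)) \<in> poly_edges m q"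
proof -
  have zero: "\<forall>k\<in>{1..m} - {a, b}. c k = 0" using assms(1) by blast
  have "(\<Sum>k=1..m. c k) = (\<Sum>k\<in>{a,b}. c k)"
    using zero ab by (intro sum.mono_neutral_right) auto
  then have cb: "c b = 1 - c a" using c ab(1) by simp
  have "(\<Sum>k=1..m. smult (c k) (q k)) = (\<Sum>k\<in>{a,b}. smult (c k) (q k))"
    using zero ab by (intro sum.mono_neutral_right) auto
  also have "\<dots> = smult (c a) (q a) + smult (1 - c a) (q b)"
    using ab(1) cb by simp
  finally have "(\<Sum>k=1..m. smult (c k) (q k)) = smult (c a) (q a) + smult (1 - c a) (q b)" .
  moreover have "c a \<in> {0..1}" using c(2) ab cb by (auto simp: Ball_def)
  ultimately show ?thesis
    unfolding poly_edges_def using ab by blast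
qed

lemma poly_vertices_subset_edges: "poly_vertices m q \<subseteq> poly_edges m q"
proof
  fix r assume "r \<in> poly_vertices m q"
  then obtain k where "k \<in> {1..m}" "r = q k" by (auto simp: poly_vertices_def)
  then have "r = smult 1 (q k) + smult (1 - 1) (q k) \<and> k \<in> {1..m} \<and> k \<in> {1..m} \<and> (1::real) \<in> {0..1}"
    by simp
  then show "r \<in> poly_edges m q" unfolding poly_edges_def by blast
qed

lemma poly_edges_subset_hull: "poly_edges m q \<subseteq> poly_hull m q"
proof
  fix r assume "r \<in> poly_edges m q"
  then obtain a b t where *: "a \<in> {1..m}" "b \<in> {1..m}" "t \<in> {0..1}"
    "r = smult t (q a) + smult (1 - t) (q b)" by (auto simp: poly_edges_def)
  define c where "c = (\<lambda>k. (if k = a then t else 0) + (if k = b then 1 - t else 0))"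
  have if_smult: "smult (if P then x else 0) y = (if P then smult x y else 0)"
    for P and x :: real and y by simp
  have "r = (\<Sum>k=1..m. smult (c k) (q k))"
    using * by (simp add: c_def smult_add_left sum.distrib if_smult)
  moreover have "(\<Sum>k=1..m. c k) = 1"
    using * by (simp add: c_def sum.distrib)
  moreover have "\<forall>k\<in>{1..m}. 0 \<le> c k" using * by (auto simp: c_def)
  ultimately show "r \<in> poly_hull m q" unfolding poly_hull_def by blast
qed

lemma edge_matrices_subset_family: "edge_matrices m p \<subseteq> matrix_family m p"
proof
  fix A assume "A \<in> edge_matrices m p"
  then obtain l where l: "\<And>r. A $ r $ l r \<in> poly_edges m (p r (l r))"
    "\<And>r j. j \<noteq> l r \<Longrightarrow> A $ r $ j \<in> poly_vertices m (p r j)"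
    unfolding edge_matrices_def by blast
  have "A $ i $ j \<in> poly_edges m (p i j)" for i j
    using l poly_vertices_subset_edges by (cases "j = l i") blast+
  then show "A \<in> matrix_family m p"
    unfolding matrix_family_def using poly_edges_subset_hull by blast
qed

section \<open>Perturbing the coefficients of one row or column\<close>

lemma comb_matrix_perturbed:
  "comb_matrix m p (\<lambda>i j k. c i j k + x * u i j k + y * v i j k) $ i $ j =
    comb_matrix m p c $ i $ j + smult x (comb_matrix m p u $ i $ j) + smult y (comb_matrix m p v $ i $ j)"
proof -
  have "smult a (\<Sum>k=1..m. r k) = (\<Sum>k=1..m. smult a (r k))" for a and r :: "nat \<Rightarrow> real poly"
    using sum_distrib_left[of "[:a:]" r "{1..m}"] by simp
  then show ?thesis
    by (simp add: comb_matrix_def smult_add_left sum.distrib)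
qed

text \<open>A simultaneous perturbation of several entries is not affine for the determinant in
  general. It is when all of them lie in one row (or column), by multilinearity, and this is why
  rows and columns are the sets of entries on which the edge argument can act.\<close>

lemma det_affine_in_row:
  assumes "\<And>i j k. i \<noteq> r \<Longrightarrow> u i j k = 0 \<and> v i j k = 0"
  shows "\<exists>f g h. \<forall>x y. det (comb_matrix m p (\<lambda>i j k. c i j k + x * u i j k + y * v i j k))
    = f + smult x g + smult y h"
proof -
  let ?A = "comb_matrix m p c" and ?U = "comb_matrix m p u" and ?V = "comb_matrix m p v"
  have zero: "?U $ i $ j = 0" "?V $ i $ j = 0" if "i \<noteq> r" for i j
    using assms[OF that] by (simp_all add: comb_matrix_def)
  have "comb_matrix m p (\<lambda>i j k. c i j k + x * u i j k + y * v i j k) =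
      (\<chi> i. if i = r then (?A $ i + [:x:] *s ?U $ i) + [:y:] *s ?V $ i else ?A $ i)" for x y
    by (simp add: vec_eq_iff comb_matrix_perturbed zero)
  then have "det (comb_matrix m p (\<lambda>i j k. c i j k + x * u i j k + y * v i j k)) =
      det (\<chi> i. if i = r then ?A $ i else ?A $ i)
      + smult x (det (\<chi> i. if i = r then ?U $ i else ?A $ i))
      + smult y (det (\<chi> i. if i = r then ?V $ i else ?A $ i))" for x y
    by (simp only: det_row_add det_row_mul) simp
  then show ?thesis by blast
qed

lemma comb_matrix_transpose:
  "comb_matrix m (\<lambda>i j. p j i) (\<lambda>i j. c j i) = transpose (comb_matrix m p c)"
  by (simp add: comb_matrix_def transpose_def)

lemma det_affine_in_column:
  assumes "\<And>i j k. j \<noteq> r \<Longrightarrow> u i j k = 0 \<and> v i j k = 0"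
  shows "\<exists>f g h. \<forall>x y. det (comb_matrix m p (\<lambda>i j k. c i j k + x * u i j k + y * v i j k))
    = f + smult x g + smult y h"
proof -
  have "\<exists>f g h. \<forall>x y. det (comb_matrix m (\<lambda>i j. p j i) (\<lambda>i j k. c j i k + x * u j i k + y * v j i k))
    = f + smult x g + smult y h"
    by (rule det_affine_in_row[of r "\<lambda>i j. u j i" "\<lambda>i j. v j i"]) (use assms in blast)
  then show ?thesis
    using comb_matrix_transpose[of m p "\<lambda>i j k. c i j k + _ * u i j k + _ * v i j k"] by simp
qed

text \<open>The coefficient arrays \<open>c + x u + y v\<close> that are still convex form a compact polygon in the
  \<open>(x, y)\<close> plane, on which the determinant is an affine family of constant degree. The edge
  argument gives a matrix on the frontier of this polygon that also has a root outside \<open>D\<close>, and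
  there a coefficient that was positive has become zero. The two indices at which \<open>u\<close> and \<open>v\<close> take the values \<open>(1, 0)\<close>
  and \<open>(0, 1)\<close> witness their independence and bound the polygon.\<close>

lemma shrink_support:
  fixes c u v :: "'n::finite \<Rightarrow> 'n \<Rightarrow> nat \<Rightarrow> real"
  assumes c: "convex_coeffs m c" and unstable: "\<not> D_stable D (comb_matrix m p c)"
    and D: "open D" "simply_connected D"
    and deg: "\<And>A. A \<in> matrix_family m p \<Longrightarrow> ext_degree (det A) = e"
    and sum0: "\<And>i j. (\<Sum>k=1..m. u i j k) = 0" "\<And>i j. (\<Sum>k=1..m. v i j k) = 0"
    and sub: "supp m u \<subseteq> supp m c" "supp m v \<subseteq> supp m c"
    and k1: "k1 \<in> {1..m}" "u i1 j1 k1 = 1" "v i1 j1 k1 = 0"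
    and k2: "k2 \<in> {1..m}" "u i2 j2 k2 = 0" "v i2 j2 k2 = 1"
    and affine: "\<exists>f g h. \<forall>x y. det (comb_matrix m p (\<lambda>i j k. c i j k + x * u i j k + y * v i j k))
      = f + smult x g + smult y h"
  obtains c' where "convex_coeffs m c'" "\<not> D_stable D (comb_matrix m p c')"
    "supp m c' \<subset> supp m c"
proof -
  define w where "w = (\<lambda>z :: real \<times> real. \<lambda>i j k. c i j k + fst z * u i j k + snd z * v i j k)"
  define K where "K = {z. convex_coeffs m (w z)}"
  obtain f g h where fgh: "\<And>z. det (comb_matrix m p (w z)) = f + smult (fst z) g + smult (snd z) h"
    using affine unfolding w_def by blast
  have sum1: "(\<Sum>k=1..m. w z i j k) = 1" for z i j
    using c sum0 by (simp add: w_def convex_coeffs_def sum.distrib sum_distrib_left[symmetric])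
  have K_eq: "K = (\<Inter>i. \<Inter>j. \<Inter>k\<in>{1..m}. {z. 0 \<le> w z i j k})"
    unfolding K_def convex_coeffs_def sum1 by blast
  have contw: "continuous_on UNIV (\<lambda>z. w z i j k)" for i j k
    unfolding w_def by (intro continuous_intros)
  have "closed K"
    unfolding K_eq by (intro closed_INT ballI closed_Collect_le contw continuous_intros)
  have "K \<subseteq> cbox (-1, -1) (1, 1)"
  proof
    fix z assume "z \<in> K"
    then have "0 \<le> w z i1 j1 k1" "w z i1 j1 k1 \<le> 1" "0 \<le> w z i2 j2 k2" "w z i2 j2 k2 \<le> 1"
      using k1(1) k2(1) by (auto simp: K_def convex_coeffs_nonneg convex_coeffs_le_1)
    moreover have "0 \<le> c i1 j1 k1" "c i1 j1 k1 \<le> 1" "0 \<le> c i2 j2 k2" "c i2 j2 k2 \<le> 1"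
      using c k1(1) k2(1) by (auto simp: convex_coeffs_nonneg convex_coeffs_le_1)
    ultimately have "-1 \<le> fst z" "fst z \<le> 1" "-1 \<le> snd z" "snd z \<le> 1"
      using k1 k2 by (auto simp: w_def)
    then show "z \<in> cbox (-1, -1) (1, 1)"
      by (cases z) (simp add: cbox_Pair_eq)
  qed
  then have "compact K"
    using \<open>closed K\<close> bounded_cbox bounded_subset compact_eq_bounded_closed by blast
  have "w (0, 0) = c" by (simp add: w_def)
  then have "(0, 0) \<in> K" using c by (simp add: K_def)
  obtain s0 where "cpoly (det (comb_matrix m p (w (0, 0)))) s0 = 0" "s0 \<notin> D"
    using unstable \<open>w (0, 0) = c\<close> by (auto simp: D_stable_def)
  then obtain z s where z: "z \<in> frontier K" and s: "cpoly (det (comb_matrix m p (w z))) s = 0" "s \<notin> D"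
    using bad_root_on_frontier[OF \<open>compact K\<close> D, of f g h e "(0, 0)" s0] deg \<open>(0, 0) \<in> K\<close>
    unfolding fgh[symmetric] K_def matrix_family_eq by blast
  then have "z \<in> K" using \<open>closed K\<close> frontier_subset_closed by blast
  have zero_off: "u i j k = 0 \<and> v i j k = 0" if "k \<in> {1..m}" "(i, j, k) \<notin> supp m c" for i j k
    using sub that by (auto simp: supp_def)
  have supp_w: "supp m (w z') \<subseteq> supp m c" for z'
    using zero_off by (fastforce simp: supp_def w_def)
  \<comment> \<open>If no coefficient had vanished, all those in the support would be positive near \<open>z\<close>.\<close>
  have "supp m (w z) \<noteq> supp m c"
  proof
    assume eq: "supp m (w z) = supp m c"
    define W where "W = (\<Inter>(i, j, k)\<in>supp m c. {z. 0 < w z i j k})"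
    have "open W"
      unfolding W_def using contw
      by (intro open_INT) (auto intro!: open_Collect_less continuous_intros)
    moreover have "W \<subseteq> K"
    proof
      fix z' assume "z' \<in> W"
      then have "0 < w z' i j k" if "(i, j, k) \<in> supp m c" for i j k
        using that unfolding W_def by blast
      moreover have "w z' i j k = 0" if "k \<in> {1..m}" "(i, j, k) \<notin> supp m c" for i j k
        using that supp_w[of z'] unfolding supp_def by blast
      ultimately show "z' \<in> K"
        unfolding K_eq by (smt (verit, best) INT_I mem_Collect_eq)
    qed
    moreover have "z \<in> W"
    proof -
      have "0 < w z i j k" if "(i, j, k) \<in> supp m c" for i j k
      proof -
        have "k \<in> {1..m}" "w z i j k \<noteq> 0"
          using that unfolding eq[symmetric] by (auto simp: supp_def)
        moreover have "0 \<le> w z i j k"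
          using \<open>z \<in> K\<close> \<open>k \<in> {1..m}\<close> unfolding K_eq by blast
        ultimately show ?thesis by simp
      qed
      then show ?thesis unfolding W_def by blast
    qed
    ultimately have "z \<in> interior K" by (metis interiorI)
    then show False using z by (simp add: frontier_def)
  qed
  then have "supp m (w z) \<subset> supp m c" using supp_w[of z] by blast
  moreover have "convex_coeffs m (w z)" using \<open>z \<in> K\<close> by (simp add: K_def)
  moreover have "\<not> D_stable D (comb_matrix m p (w z))" using s unfolding D_stable_def by blast
  ultimately show thesis using that by blast
qed

definition exchange :: "'n \<Rightarrow> 'n \<Rightarrow> nat \<Rightarrow> nat \<Rightarrow> 'n \<Rightarrow> 'n \<Rightarrow> nat \<Rightarrow> real" where
  "exchange i j a b = (\<lambda>i' j' k. if i' = i \<and> j' = j then (if k = a then 1 else 0) - (if k = b then 1 else 0) else 0)"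

lemma sum_exchange:
  assumes "a \<in> {1..m}" "b \<in> {1..m}"
  shows "(\<Sum>k=1..m. exchange i j a b i' j' k) = 0"
  using assms by (cases "i' = i \<and> j' = j") (auto simp: exchange_def sum_subtractf intro!: sum.neutral)

text \<open>Two exchanges on a common line (row or column) span a two-parameter family as soon as each
  gains weight at an index which the other leaves alone. The indices \<open>b\<close> and \<open>b'\<close> that lose weight
  may coincide; this covers an entry with three support indices, besides two entries with two
  support indices each.\<close>

lemma two_exchanges_shrink_support:
  fixes c :: "'n::finite \<Rightarrow> 'n \<Rightarrow> nat \<Rightarrow> real"
  assumes c: "convex_coeffs m c" "\<not> D_stable D (comb_matrix m p c)"
    and D: "open D" "simply_connected D"
    and deg: "\<And>A. A \<in> matrix_family m p \<Longrightarrow> ext_degree (det A) = e"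
    and ab: "(i, j, a) \<in> supp m c" "(i, j, b) \<in> supp m c" "a \<noteq> b"
    and ab': "(i', j', a') \<in> supp m c" "(i', j', b') \<in> supp m c" "a' \<noteq> b'"
    and line: "i = i' \<or> j = j'"
    and indep: "(i, j, a) \<noteq> (i', j', a')" "(i, j, a) \<noteq> (i', j', b')" "(i, j, b) \<noteq> (i', j', a')"
  obtains c' where "convex_coeffs m c'" "\<not> D_stable D (comb_matrix m p c')"
    "supp m c' \<subset> supp m c"
proof (rule shrink_support[OF c D deg, where u = "exchange i j a b" and v = "exchange i' j' a' b'"
      and ?i1.0 = i and ?j1.0 = j and ?k1.0 = a and ?i2.0 = i' and ?j2.0 = j' and ?k2.0 = a'])
  have m: "a \<in> {1..m}" "b \<in> {1..m}" "a' \<in> {1..m}" "b' \<in> {1..m}"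
    using ab ab' by (auto simp: supp_def)
  show "a \<in> {1..m}" "a' \<in> {1..m}" by fact+
  show "(\<Sum>k=1..m. exchange i j a b r s k) = 0" "(\<Sum>k=1..m. exchange i' j' a' b' r s k) = 0" for r s
    by (rule sum_exchange[OF m(1,2)] sum_exchange[OF m(3,4)])+
  show "supp m (exchange i j a b) \<subseteq> supp m c" "supp m (exchange i' j' a' b') \<subseteq> supp m c"
    using ab ab' by (auto simp: supp_def exchange_def split: if_splits)
  show "exchange i j a b i j a = 1" "exchange i' j' a' b' i j a = 0"
    "exchange i j a b i' j' a' = 0" "exchange i' j' a' b' i' j' a' = 1"
    using ab(3) ab'(3) indep by (auto simp: exchange_def)
  show "\<exists>f g h. \<forall>x y. det (comb_matrix m p
      (\<lambda>r s k. c r s k + x * exchange i j a b r s k + y * exchange i' j' a' b' r s k))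
      = f + smult x g + smult y h"
    using line
  proof
    assume "i = i'"
    then show ?thesis by (intro det_affine_in_row[where r = i]) (auto simp: exchange_def)
  next
    assume "j = j'"
    then show ?thesis by (intro det_affine_in_column[where r = j]) (auto simp: exchange_def)
  qed
qed (use that in blast)

section \<open>Sparse supports are edge matrices\<close>

lemma partial_matching_extends:
  fixes N :: "'n::finite \<Rightarrow> 'n \<Rightarrow> bool"
  assumes functional: "\<And>i j j'. N i j \<Longrightarrow> N i j' \<Longrightarrow> j = j'"
    and inj: "\<And>i i' j. N i j \<Longrightarrow> N i' j \<Longrightarrow> i = i'"
  obtains l where "l permutes UNIV" "\<And>i j. N i j \<Longrightarrow> l i = j"
proof -
  define S where "S = {i. \<exists>j. N i j}"
  define f where "f = (\<lambda>i. THE j. N i j)"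
  have f: "f i = j" if "N i j" for i j
    unfolding f_def using that functional by blast
  have "inj_on f S"
    by (rule inj_onI) (use f inj in \<open>auto simp: S_def\<close>)
  then have bf: "bij_betw f S (f ` S)" by (rule inj_on_imp_bij_betw)
  have "card (- S) = card (- f ` S)"
    using card_image[OF \<open>inj_on f S\<close>] by (simp add: Compl_eq_Diff_UNIV card_Diff_subset)
  then obtain g where bg: "bij_betw g (- S) (- f ` S)"
    using finite_same_card_bij[of "- S" "- f ` S"] by auto
  define l where "l = (\<lambda>i. if i \<in> S then f i else g i)"
  have "bij_betw l (S \<union> - S) (f ` S \<union> - f ` S)"
    unfolding l_def by (rule bij_betw_disjoint_Un[OF bf bg]) auto
  then have "l permutes UNIV"
    by (intro bij_imp_permutes) (simp_all add: Compl_partition)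
  moreover have "l i = j" if "N i j" for i j
    using that f by (auto simp: l_def S_def)
  ultimately show thesis using that by blast
qed

text \<open>The hypothesis says that the support does not admit the two exchanges of
  \<open>two_exchanges_shrink_support\<close>. Hence an entry has at most two support indices, and no two
  entries of the same row or the same column have two. The entries with two support indices
  therefore form a partial matching of rows and columns, and any permutation that extends it
  shows the matrix to be an edge matrix.\<close>

lemma sparse_support_edge_matrix:
  fixes c :: "'n::finite \<Rightarrow> 'n \<Rightarrow> nat \<Rightarrow> real"
  assumes c: "convex_coeffs m c"
    and sparse: "\<And>i j a b i' j' a' b'.
      \<lbrakk>(i, j, a) \<in> supp m c; (i, j, b) \<in> supp m c; a \<noteq> b;
       (i', j', a') \<in> supp m c; (i', j', b') \<in> supp m c; a' \<noteq> b'; i = i' \<or> j = j'\<rbrakk>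
      \<Longrightarrow> (i, j, a) = (i', j', a') \<or> (i, j, a) = (i', j', b') \<or> (i, j, b) = (i', j', a')"
  shows "comb_matrix m p c \<in> edge_matrices m p"
proof -
  define N where "N = (\<lambda>i j. \<exists>a b. (i, j, a) \<in> supp m c \<and> (i, j, b) \<in> supp m c \<and> a \<noteq> b)"
  have "\<exists>l. l permutes UNIV \<and> (\<forall>i j. N i j \<longrightarrow> l i = j)"
  proof (rule partial_matching_extends[of N])
    show "j = j'" if "N i j" "N i j'" for i j j'
      using that sparse[of i j _ _ i j'] unfolding N_def by (metis prod.inject)
    show "i = i'" if "N i j" "N i' j" for i i' j
      using that sparse[of i j _ _ i' j] unfolding N_def by (metis prod.inject)
  qed blast
  then obtain l where l: "l permutes UNIV" "\<And>i j. N i j \<Longrightarrow> l i = j" by blast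
  have sum1: "(\<Sum>k=1..m. c i j k) = 1" for i j using c by (simp add: convex_coeffs_def)
  have vertex: "comb_matrix m p c $ i $ j \<in> poly_vertices m (p i j)" if "\<not> N i j" for i j
  proof -
    obtain a where a: "a \<in> {1..m}" "c i j a \<noteq> 0"
      using sum1[of i j] by (metis sum.neutral zero_neq_one)
    have "comb_matrix m p c $ i $ j = p i j a"
      unfolding comb_matrix_def vec_lambda_beta
      using that a by (intro poly_hull_vertex sum1) (auto simp: N_def supp_def)
    then show ?thesis using a by (auto simp: poly_vertices_def)
  qed
  have edge: "comb_matrix m p c $ i $ j \<in> poly_edges m (p i j)" for i j
  proof (cases "N i j")
    case True
    then obtain a b where ab: "(i, j, a) \<in> supp m c" "(i, j, b) \<in> supp m c" "a \<noteq> b"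
      unfolding N_def by blast
    have "k = a \<or> k = b" if "k \<in> {1..m}" "c i j k \<noteq> 0" for k
      using sparse[of i j a b i j k b] ab that by (auto simp: supp_def)
    then have "(\<Sum>k=1..m. smult (c i j k) (p i j k)) \<in> poly_edges m (p i j)"
      using ab c by (intro poly_hull_edge sum1) (auto simp: supp_def convex_coeffs_def)
    then show ?thesis by (simp add: comb_matrix_def)
  next
    case False
    then show ?thesis using vertex poly_vertices_subset_edges by blast
  qed
  show ?thesis
    unfolding edge_matrices_def using l edge vertex by blast
qed

section \<open>The edge theorem for polynomial matrices\<close>

theorem theorem1:
  fixes m :: nat
    and p :: "'n::finite \<Rightarrow> 'n \<Rightarrow> nat \<Rightarrow> real poly"
    and D :: "complex set"
  assumes "m \<ge> 1"
    and "open D" and "simply_connected D"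
    and "\<exists>d. \<forall>A \<in> matrix_family m p. ext_degree (det A) = d"
  shows "D_stable_set D (matrix_family m p) \<longleftrightarrow> D_stable_set D (edge_matrices m p)"
proof
  assume "D_stable_set D (matrix_family m p)"
  then show "D_stable_set D (edge_matrices m p)"
    using edge_matrices_subset_family unfolding D_stable_set_def by blast
next
  assume edges: "D_stable_set D (edge_matrices m p)"
  obtain e where deg: "\<And>A. A \<in> matrix_family m p \<Longrightarrow> ext_degree (det A) = e"
    using assms(4) by blast
  \<comment> \<open>Coefficient arrays of unstable matrices; one of minimal support yields an edge matrix.\<close>
  define Bad where "Bad = (\<lambda>c. convex_coeffs m c \<and> \<not> D_stable D (comb_matrix m p c))"
  show "D_stable_set D (matrix_family m p)"
  proof (rule ccontr)
    assume "\<not> D_stable_set D (matrix_family m p)"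
    then obtain c0 where "Bad c0"
      by (auto simp: D_stable_set_def matrix_family_eq Bad_def)
    then obtain c where c: "Bad c" and least: "\<And>c'. Bad c' \<Longrightarrow> card (supp m c) \<le> card (supp m c')"
      using ex_has_least_nat[of Bad c0 "\<lambda>c. card (supp m c)"] by blast
    have minimal: "\<not> supp m c' \<subset> supp m c" if "Bad c'" for c'
      using least[OF that] psubset_card_mono[OF finite_supp] by (metis not_less)
    have "comb_matrix m p c \<in> edge_matrices m p"
    proof (rule sparse_support_edge_matrix)
      fix i j a b i' j' a' b'
      assume pos: "(i, j, a) \<in> supp m c" "(i, j, b) \<in> supp m c" "a \<noteq> b"
        "(i', j', a') \<in> supp m c" "(i', j', b') \<in> supp m c" "a' \<noteq> b'" "i = i' \<or> j = j'"
      show "(i, j, a) = (i', j', a') \<or> (i, j, a) = (i', j', b') \<or> (i, j, b) = (i', j', a')"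
      proof (rule ccontr)
        assume "\<not> ?thesis"
        then obtain c' where "Bad c'" "supp m c' \<subset> supp m c"
          using two_exchanges_shrink_support[of m c D p e i j a b i' j' a' b'] c assms(2,3) deg pos
          unfolding Bad_def by (metis (no_types, lifting))
        then show False using minimal by blast
      qed
    qed (use c in \<open>simp add: Bad_def\<close>)
    then show False
      using edges c by (auto simp: D_stable_set_def Bad_def)
  qed
qed

end
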